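(* Let $X=\mathbb{R}$ and let $H=\{h_1,h_2,h_3,h_4\}$ be the set of functions $\mathbb{R}\to\mathbb{R}$ given by $h_1(x)=-|x-1|+2$, $h_2(x)=-|x+1|+2$, $h_3(x)=-|x|+2$, $h_4(x)=0$. Let $A=\{h_1,h_2\}$ and $B=\{h_3,h_4\}$. Then $A$ and $B$ are disjoint $H$-convex sets, but $A$ is not $X$-separable from $B$ and $B$ is not $X$-separable from $A$. In particular, disjoint abstract convex sets cannot in general be separated.
   Context: For a set $H$ of functions on $X$ and a function $f:X\to\mathbb{R}\cup\{+\infty\}$ (or $f\equiv-\infty$), the $H$-support set of $f$ is $\operatorname{supp}(f,H)=\{u\in H: u(x)\le f(x)\ \forall x\in X\}$. A function is $H$-convex if it is the pointwise supremum of some subset of $H$. A subset of $H$ is called $H$-convex if it is the $H$-support set of some $H$-convex function (equivalently, of some function). For $H$-convex sets $A,B\subset H$, $A$ is said to be $X$-separable from $B$ if there exists $x\in X$ such that $u(x)\le l(x)$ for all $u\in A$ and all $l\in B$. *)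

theory Defs
  imports Complex_Main "HOL-Library.Extended_Real"
begin

text \<open>
  The ground set \<open>X\<close> is the whole type \<open>'a\<close>, and elementary functions are real-valued. Functions
  with values in the reals extended by plus infinity, and the constant minus infinity, are
  represented as functions into \<^typ>\<open>ereal\<close>.
\<close>

definition supp_set :: "('a \<Rightarrow> ereal) \<Rightarrow> ('a \<Rightarrow> real) set \<Rightarrow> ('a \<Rightarrow> real) set" where
  "supp_set f H = {u \<in> H. \<forall>x. ereal (u x) \<le> f x}"

text \<open>
  The supremum is taken in \<^typ>\<open>ereal\<close>. So the empty subfamily yields the constant minus infinity,
  and a nonempty one yields a function that never takes the value minus infinity: no other
  extended-valued functions arise.
\<close>

definition H_convex_fun :: "('a \<Rightarrow> real) set \<Rightarrow> ('a \<Rightarrow> ereal) \<Rightarrow> bool" where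
  "H_convex_fun H f \<longleftrightarrow> (\<exists>U\<subseteq>H. \<forall>x. f x = (SUP u\<in>U. ereal (u x)))"

definition H_convex_set :: "('a \<Rightarrow> real) set \<Rightarrow> ('a \<Rightarrow> real) set \<Rightarrow> bool" where
  "H_convex_set H A \<longleftrightarrow> (\<exists>f. H_convex_fun H f \<and> A = supp_set f H)"

definition X_separable_from :: "('a \<Rightarrow> real) set \<Rightarrow> ('a \<Rightarrow> real) set \<Rightarrow> bool" where
  "X_separable_from A B \<longleftrightarrow> (\<exists>x. \<forall>u\<in>A. \<forall>l\<in>B. u x \<le> l x)"

end

theory Submission
  imports Defs
begin

text \<open>A set \<open>U\<close> of elementary functions is \<open>H\<close>-convex as soon as
  every other member of \<open>H\<close> rises strictly above all of \<open>U\<close> at some point: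
  \<open>U\<close> is then the support set of its own supremum (\<open>H_convex_setI\<close>). Here
  \<open>h1\<close>, \<open>h2\<close>, \<open>h3\<close> are tents of height 2 with peaks at 1, -1,
  0, and \<open>h4\<close> is the zero line. Each tent beats the rest at its peak, and the line
  beats the outer tents far out, so both pairs are convex. Separation fails either way because the
  middle tent is never below both outer tents, and wherever it is above both, the outer tents are
  positive.\<close>

lemma H_convex_setI:
  assumes "U \<subseteq> H"
    and "\<And>h. h \<in> H - U \<Longrightarrow> \<exists>x c. c < h x \<and> (\<forall>u\<in>U. u x \<le> c)"
  shows "H_convex_set H U"
  unfolding H_convex_set_def
proof (intro exI conjI)
  let ?f = "\<lambda>x. SUP u\<in>U. ereal (u x)"
  show "H_convex_fun H ?f"
    using assms(1) unfolding H_convex_fun_def by blast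
  have "h \<in> U" if "h \<in> H" and le: "\<And>x. ereal (h x) \<le> ?f x" for h
  proof (rule ccontr)
    assume "h \<notin> U"
    \<comment> \<open>The real bound \<open>c\<close> keeps the inequality strict when passing to
      the supremum in the extended reals, and also covers empty \<open>U\<close>.\<close>
    then obtain x c where "c < h x" and "\<forall>u\<in>U. u x \<le> c"
      using assms(2) \<open>h \<in> H\<close> by blast
    then have "?f x \<le> ereal c"
      by (intro SUP_least) simp
    with le[of x] have "ereal (h x) \<le> ereal c"
      by (rule order_trans)
    with \<open>c < h x\<close> show False
      by simp
  qed
  moreover have "ereal (u x) \<le> ?f x" if "u \<in> U" for u x
    using that by (rule SUP_upper)
  ultimately show "U = supp_set ?f H"
    using assms(1) unfolding supp_set_def by blast
qed

theorem mainTheorem1: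
  fixes h1 h2 h3 h4 :: "real \<Rightarrow> real" and H A B :: "(real \<Rightarrow> real) set"
  assumes "h1 = (\<lambda>x. - \<bar>x - 1\<bar> + 2)"
    and "h2 = (\<lambda>x. - \<bar>x + 1\<bar> + 2)"
    and "h3 = (\<lambda>x. - \<bar>x\<bar> + 2)"
    and "h4 = (\<lambda>x. 0)"
    and "H = {h1, h2, h3, h4}"
    and "A = {h1, h2}"
    and "B = {h3, h4}"
  shows "(H_convex_set H A \<and> H_convex_set H B \<and> A \<inter> B = {} \<and>
          \<not> X_separable_from A B \<and> \<not> X_separable_from B A) \<and>
         \<not> (\<forall>H' A' B' :: (real \<Rightarrow> real) set.
              H_convex_set H' A' \<and> H_convex_set H' B' \<and> A' \<inter> B' = {} \<longrightarrow>
              X_separable_from A' B' \<or> X_separable_from B' A')"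
proof -
  note h_defs = assms(1-4)
  have "\<exists>x c. c < h x \<and> (\<forall>u\<in>A. u x \<le> c)" if "h \<in> H - A" for h
  proof -
    from that consider "h = h3" | "h = h4"
      using assms(5,6) by blast
    then show ?thesis
    proof cases
      case 1
      \<comment> \<open>At the peak of \<open>h3\<close> both outer tents equal 1.\<close>
      then have "1 < h 0 \<and> (\<forall>u\<in>A. u 0 \<le> 1)"
        by (simp add: assms(6) h_defs)
      then show ?thesis
        by blast
    next
      case 2
      \<comment> \<open>Both outer tents are negative once |x| > 3; at 4 the larger one,
        \<open>h1\<close>, equals -1.\<close>
      then have "-1 < h 4 \<and> (\<forall>u\<in>A. u 4 \<le> -1)"
        by (simp add: assms(6) h_defs)
      then show ?thesis
        by blast
    qed
  qed
  then have A: "H_convex_set H A"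
    using assms(5,6) by (intro H_convex_setI) auto
  have "\<exists>x c. c < h x \<and> (\<forall>u\<in>B. u x \<le> c)" if "h \<in> H - B" for h
  proof -
    from that consider "h = h1" | "h = h2"
      using assms(5,7) by blast
    then show ?thesis
    proof cases
      case 1
      \<comment> \<open>The point is the peak of \<open>h1\<close>, where \<open>h3\<close> is 1 and
        \<open>h4\<close> is 0; the case of \<open>h2\<close> is the mirror image.\<close>
      then have "1 < h 1 \<and> (\<forall>u\<in>B. u 1 \<le> 1)"
        by (simp add: assms(7) h_defs)
      then show ?thesis
        by blast
    next
      case 2
      then have "1 < h (-1) \<and> (\<forall>u\<in>B. u (-1) \<le> 1)"
        by (simp add: assms(7) h_defs)
      then show ?thesis
        by blast
    qed
  qed
  then have B: "H_convex_set H B"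
    using assms(5,7) by (intro H_convex_setI) auto
  \<comment> \<open>Evaluation at 0 distinguishes the functions: \<open>h1\<close> and
    \<open>h2\<close> give 1, while \<open>h3\<close> gives 2 and \<open>h4\<close> gives 0.\<close>
  have "h1 0 \<noteq> h3 0" "h1 0 \<noteq> h4 0" "h2 0 \<noteq> h3 0" "h2 0 \<noteq> h4 0"
    by (simp_all add: h_defs)
  then have disjoint: "A \<inter> B = {}"
    using assms(6,7) by auto
  have AB: "\<not> X_separable_from A B"
  proof
    assume "X_separable_from A B"
    then obtain x where x: "\<forall>u\<in>A. \<forall>l\<in>B. u x \<le> l x"
      unfolding X_separable_from_def ..
    \<comment> \<open>Lying below \<open>h3\<close> forces x \<le> 1/2 for \<open>h1\<close> and x
      \<ge> -1/2 for \<open>h2\<close>; on that interval both outer tents are at least 1/2, hence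
      above \<open>h4\<close>.\<close>
    have "h1 x \<le> h3 x" "h1 x \<le> h4 x" "h2 x \<le> h3 x" "h2 x \<le> h4 x"
      using x by (simp_all only: assms(6,7) ball_simps simp_thms)
    then show False
      unfolding h_defs by linarith
  qed
  have BA: "\<not> X_separable_from B A"
  proof
    assume "X_separable_from B A"
    then obtain x where x: "\<forall>u\<in>B. \<forall>l\<in>A. u x \<le> l x"
      unfolding X_separable_from_def ..
    \<comment> \<open>These two inequalities mean x \<ge> 1/2 and x \<le> -1/2.\<close>
    have "h3 x \<le> h1 x" "h3 x \<le> h2 x"
      using x by (simp_all only: assms(6,7) ball_simps simp_thms)
    then show False
      unfolding h_defs by linarith
  qed
  have "H_convex_set H A \<and> H_convex_set H B \<and> A \<inter> B = {} \<and>
      \<not> X_separable_from A B \<and> \<not> X_separable_from B A"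
    by (intro conjI A B disjoint AB BA)
  \<comment> \<open>The same \<open>H\<close>, \<open>A\<close>, \<open>B\<close> refute the general
    separation claim.\<close>
  then show ?thesis
    by blast
qed

end
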